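(* Let $G$ be a finite simple graph such that $\mathrm{Z}_t(G)$ exists, and let $v$ be a vertex of $G$ such that the graph $G-v$ (obtained by deleting $v$ and its incident edges) has no isolated vertices. Then $$\mathrm{Z}_t(G)-\mathrm{Z}_t(G-v)\le 2.$$
   Context: Zero forcing: given a set $B\subseteq V(G)$ of initially blue vertices (all others white), the color change rule allows a blue vertex $b$ to turn a white vertex $w$ blue if $w$ is the unique white neighbor of $b$. $B$ is a zero forcing set if repeated application of this rule eventually turns all of $V(G)$ blue. A set $B\subseteq V(G)$ with $|B|=m\ge 1$ is a fault tolerant zero forcing set if every subset $F\subseteq B$ with $|F|=m-1$ is a zero forcing set of $G$. $\mathrm{Z}_t(G)$ is the minimum cardinality of a fault tolerant zero forcing set of $G$; it exists if some fault tolerant zero forcing set exists. *)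

theory Defs
  imports "Graph_Theory.Digraph"
begin

(* A finite simple graph is an instance of the library locale graph: a finite, loop-free,
   symmetric digraph without parallel arcs. Each undirected edge is a pair of opposite arcs. *)

definition neighbors :: "('a, 'b) pre_digraph \<Rightarrow> 'a \<Rightarrow> 'a set" where
  "neighbors G u = {w \<in> verts G. u \<rightarrow>\<^bsub>G\<^esub> w}"

definition isolated_vertex :: "('a, 'b) pre_digraph \<Rightarrow> 'a \<Rightarrow> bool" where
  "isolated_vertex G u \<longleftrightarrow> u \<in> verts G \<and> neighbors G u = {}"

(* B and B' are the sets of blue vertices before and after one application of the rule. *)
definition color_change :: "('a, 'b) pre_digraph \<Rightarrow> 'a set \<Rightarrow> 'a set \<Rightarrow> bool" where
  "color_change G B B' \<longleftrightarrow> (\<exists>b\<in>B. \<exists>w. neighbors G b - B = {w} \<and> B' = insert w B)"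

definition zero_forcing_set :: "('a, 'b) pre_digraph \<Rightarrow> 'a set \<Rightarrow> bool" where
  "zero_forcing_set G B \<longleftrightarrow> B \<subseteq> verts G \<and> (color_change G)\<^sup>*\<^sup>* B (verts G)"

definition fault_tolerant_zfs :: "('a, 'b) pre_digraph \<Rightarrow> 'a set \<Rightarrow> bool" where
  "fault_tolerant_zfs G B \<longleftrightarrow> B \<subseteq> verts G \<and> card B \<ge> 1 \<and>
     (\<forall>F. F \<subseteq> B \<and> card F = card B - 1 \<longrightarrow> zero_forcing_set G F)"

definition Zt_exists :: "('a, 'b) pre_digraph \<Rightarrow> bool" where
  "Zt_exists G \<longleftrightarrow> (\<exists>B. fault_tolerant_zfs G B)"

(* Only meaningful when Zt_exists G holds. *)
definition Zt :: "('a, 'b) pre_digraph \<Rightarrow> nat" where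
  "Zt G = (LEAST m. \<exists>B. fault_tolerant_zfs G B \<and> card B = m)"

lemma Zt_exists_no_isolated:
  assumes fin: "finite (verts G)" and ne: "verts G \<noteq> {}"
    and loopfree: "\<And>u. u \<notin> neighbors G u"
    and sym: "\<And>u w. u \<in> verts G \<Longrightarrow> w \<in> neighbors G u \<Longrightarrow> u \<in> neighbors G w"
    and noiso: "\<And>u. \<not> isolated_vertex G u"
  shows "Zt_exists G"
proof -
  have "zero_forcing_set G F" if F: "F \<subseteq> verts G" "card F = card (verts G) - 1" for F
  proof -
    have "card (verts G - F) = 1"
      using F fin ne
      by (metis One_nat_def Suc_leI card_Diff_subset card_gt_0_iff diff_diff_cancel finite_subset)
    then obtain x where x: "verts G - F = {x}" by (auto simp: card_1_singleton_iff)
    then have xV: "x \<in> verts G" by blast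
    with noiso obtain y where y: "y \<in> neighbors G x" by (auto simp: isolated_vertex_def)
    have yx: "y \<noteq> x" using y loopfree by auto
    have yV: "y \<in> verts G" using y by (auto simp: neighbors_def)
    have "y \<in> F" using x yx yV by blast
    moreover have "neighbors G y - F = {x}"
    proof -
      have "x \<in> neighbors G y" by (rule sym[OF xV y])
      moreover have "neighbors G y \<subseteq> verts G" by (auto simp: neighbors_def)
      ultimately show ?thesis using x by blast
    qed
    moreover have "verts G = insert x F" using x F by blast
    ultimately have "color_change G F (verts G)" by (auto simp: color_change_def)
    then show ?thesis using F by (auto simp: zero_forcing_set_def)
  qed
  moreover have "card (verts G) \<ge> 1" using fin ne by (simp add: Suc_leI card_gt_0_iff)
  ultimately have "fault_tolerant_zfs G (verts G)" by (auto simp: fault_tolerant_zfs_def)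
  then show ?thesis by (auto simp: Zt_exists_def)
qed

lemma zero_forcing_set_empty:
  assumes "zero_forcing_set G {}"
  shows "verts G = {}"
proof -
  have "(color_change G)\<^sup>*\<^sup>* {} (verts G)" using assms by (simp add: zero_forcing_set_def)
  then show ?thesis by (cases rule: converse_rtranclpE) (auto simp: color_change_def)
qed

(* Under the hypotheses of the theorem, the number Zt of the vertex-deleted graph exists as well,
   so the default value of LEAST plays no role in it. *)
lemma Zt_exists_del_vert:
  assumes "graph G" and "Zt_exists G" and "v \<in> verts G"
    and noiso: "\<And>u. \<not> isolated_vertex (pre_digraph.del_vert G v) u"
  shows "Zt_exists (pre_digraph.del_vert G v)"
proof -
  interpret graph G by fact
  let ?H = "pre_digraph.del_vert G v"
  have ends: "x \<rightarrow>\<^bsub>?H\<^esub> y \<longleftrightarrow> x \<rightarrow>\<^bsub>G\<^esub> y \<and> x \<noteq> v \<and> y \<noteq> v" for x y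
    by (auto simp: arcs_ends_conv del_vert_simps)
  have symG: "y \<rightarrow>\<^bsub>G\<^esub> x" if "x \<rightarrow>\<^bsub>G\<^esub> y" for x y
    using that sym_arcs by (auto simp: symmetric_def dest: symD)
  have irr: "\<not> x \<rightarrow>\<^bsub>G\<^esub> x" for x
    using no_loops by (auto simp: arcs_ends_conv) 
  have "verts ?H \<noteq> {}"
  proof
    assume "verts ?H = {}"
    then have V: "verts G = {v}" using assms(3) by (auto simp: del_vert_simps)
    obtain B where B: "fault_tolerant_zfs G B" using assms(2) by (auto simp: Zt_exists_def)
    then have "B = {v}" using V by (auto simp: fault_tolerant_zfs_def subset_singleton_iff)
    then have "zero_forcing_set G {}" using B by (auto simp: fault_tolerant_zfs_def)
    then show False using zero_forcing_set_empty V by blast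
  qed
  then show ?thesis
  proof (rule Zt_exists_no_isolated[rotated])
    show "finite (verts ?H)" by (simp add: del_vert_simps)
    show "u \<notin> neighbors ?H u" for u using irr by (auto simp: neighbors_def ends)
    show "u \<in> neighbors ?H w" if "u \<in> verts ?H" "w \<in> neighbors ?H u" for u w
      using that symG by (auto simp: neighbors_def ends)
    show "\<not> isolated_vertex ?H u" for u by (rule noiso)
  qed
qed

end

theory Submission
  imports Defs
begin

text \<open>
  Let \<open>B\<close> be a fault tolerant zero forcing set of \<open>G - v\<close> and run a forcing process of \<open>G - v\<close>
  from \<open>B\<close>. Once \<open>v\<close> is blue, every force of \<open>G - v\<close> is also a force of \<open>G\<close>, so
  \<open>B \<union> {v, w}\<close> survives the loss of any vertex other than \<open>v\<close>, whatever \<open>w\<close> is. To survive the loss of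
  \<open>v\<close>, choose \<open>w\<close> as the target of the first force \<open>b \<rightarrow> w\<close> whose source is adjacent to \<open>v\<close> in \<open>G\<close>:
  with \<open>w\<close> blue from the start, \<open>b\<close> forces \<open>v\<close> instead. If there is no such force, then
  all of \<open>G - v\<close> turns blue and a neighbour of \<open>v\<close> forces \<open>v\<close> at the end; such a neighbour exists
  because a graph with an isolated vertex has no fault tolerant zero forcing set.
\<close>

lemma color_change_rtranclp_subset:
  assumes "(color_change G)\<^sup>*\<^sup>* B X"
  shows "B \<subseteq> X" and "X \<subseteq> B \<union> verts G"
proof -
  have "B \<subseteq> X \<and> X \<subseteq> B \<union> verts G"
    using assms by induction (auto simp: color_change_def neighbors_def)
  then show "B \<subseteq> X" and "X \<subseteq> B \<union> verts G" by auto
qed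

text \<open>Simulations only yield a superset \<open>Y\<close> of \<open>verts G\<close>; equality
  follows because a process started inside \<open>verts G\<close> stays there.\<close>

lemma zero_forcing_setI:
  assumes "B \<subseteq> verts G" "(color_change G)\<^sup>*\<^sup>* B Y" "verts G \<subseteq> Y"
  shows "zero_forcing_set G B"
proof -
  have "Y = verts G" using color_change_rtranclp_subset[OF assms(2)] assms(1,3) by blast
  then show ?thesis using assms(1,2) by (simp add: zero_forcing_set_def)
qed

text \<open>Each force of \<open>H\<close> can be replayed in \<open>G\<close>: its target is
  already blue, or it is the only white neighbor, since the extra \<open>G\<close>-neighbors of the
  source lie in \<open>C\<close>. Only vertices with \<open>H\<close>-neighbors can force in
  \<open>H\<close>, so \<open>nb\<close> is restricted to these; the deleted vertex thus escapes it.
  The case \<open>H = G\<close> gives monotonicity.\<close>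

lemma color_change_rtranclp_simulate:
  assumes "(color_change H)\<^sup>*\<^sup>* B X" "B \<subseteq> C"
    and nb: "\<And>b. neighbors H b \<noteq> {} \<Longrightarrow>
      neighbors H b \<subseteq> neighbors G b \<and> neighbors G b \<subseteq> neighbors H b \<union> C"
  shows "\<exists>Y. (color_change G)\<^sup>*\<^sup>* C Y \<and> X \<subseteq> Y"
  using assms(1)
proof induction
  case base
  then show ?case using \<open>B \<subseteq> C\<close> by blast
next
  case (step X X')
  then obtain Y where Y: "(color_change G)\<^sup>*\<^sup>* C Y" "X \<subseteq> Y" by blast
  obtain b w where b: "b \<in> X" "neighbors H b - X = {w}" "X' = insert w X"
    using step.hyps(2) by (auto simp: color_change_def)
  show ?case
  proof (cases "w \<in> Y")
    case True
    then show ?thesis using Y b(3) by blast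
  next
    case False
    have "neighbors H b \<noteq> {}" using b(2) by blast
    then have "neighbors G b - Y = {w}"
      using nb[of b] b(2) Y False color_change_rtranclp_subset(1)[OF Y(1)] by blast
    then have "color_change G Y (insert w Y)"
      using b(1) Y(2) by (auto simp: color_change_def)
    then show ?thesis using Y b(3) by (meson insert_mono rtranclp.rtrancl_into_rtrancl)
  qed
qed

lemma zero_forcing_set_mono:
  assumes "zero_forcing_set G B" "B \<subseteq> C" "C \<subseteq> verts G"
  shows "zero_forcing_set G C"
proof -
  have "(color_change G)\<^sup>*\<^sup>* B (verts G)" using assms(1) by (simp add: zero_forcing_set_def)
  then obtain Y where "(color_change G)\<^sup>*\<^sup>* C Y" "verts G \<subseteq> Y"
    using color_change_rtranclp_simulate[of G B "verts G" C G] assms(2) by blast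
  then show ?thesis using zero_forcing_setI assms(3) by blast
qed

text \<open>The subsets of a finite nonempty \<open>B\<close> with one element fewer are exactly the
  sets \<open>B - {x}\<close> with \<open>x\<close> in \<open>B\<close>.\<close>

lemma fault_tolerant_zfs_iff:
  assumes "finite (verts G)"
  shows "fault_tolerant_zfs G B \<longleftrightarrow>
    B \<subseteq> verts G \<and> B \<noteq> {} \<and> (\<forall>x\<in>B. zero_forcing_set G (B - {x}))"
proof -
  have "(\<forall>F. F \<subseteq> B \<and> card F = card B - 1 \<longrightarrow> zero_forcing_set G F) \<longleftrightarrow>
      (\<forall>x\<in>B. zero_forcing_set G (B - {x}))" if fin: "finite B" and ne: "B \<noteq> {}"
  proof -
    have "\<exists>x\<in>B. F = B - {x}" if F: "F \<subseteq> B" "card F = card B - 1" for F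
    proof -
      have "card B > 0" using fin ne by (simp add: card_gt_0_iff)
      then have "card (B - F) = 1"
        using F fin by (simp add: card_Diff_subset finite_subset)
      then obtain x where "B - F = {x}" by (auto simp: card_1_singleton_iff)
      then show ?thesis using F by blast
    qed
    moreover have "card (B - {x}) = card B - 1" if "x \<in> B" for x
      using that by simp
    ultimately show ?thesis by (metis Diff_subset)
  qed
  then show ?thesis
    using finite_subset[OF _ assms]
    unfolding fault_tolerant_zfs_def by (metis Suc_le_eq card_gt_0_iff One_nat_def)
qed

lemma Zt_le_card: "fault_tolerant_zfs G B \<Longrightarrow> Zt G \<le> card B"
  unfolding Zt_def by (rule Least_le) blast

lemma Zt_attained:
  assumes "Zt_exists G"
  obtains B where "fault_tolerant_zfs G B" "card B = Zt G"
  using LeastI_ex[of "\<lambda>m. \<exists>B. fault_tolerant_zfs G B \<and> card B = m"] assms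
  unfolding Zt_exists_def Zt_def by blast

lemma isolated_vertex_in_zero_forcing_set:
  assumes "zero_forcing_set G B" "v \<in> verts G" "\<And>u. v \<notin> neighbors G u"
  shows "v \<in> B"
proof -
  have "v \<in> B" if "(color_change G)\<^sup>*\<^sup>* B X" "v \<in> X" for X
    using that
  proof induction
    case (step X X')
    then show ?case using assms(3) by (auto simp: color_change_def)
  qed
  then show ?thesis using assms(1,2) by (auto simp: zero_forcing_set_def)
qed

text \<open>A vertex that no vertex can force lies in every zero forcing set, hence in each
  \<open>B - {x}\<close>; taking \<open>x = v\<close> is absurd.\<close>

lemma Zt_exists_imp_neighbor:
  assumes "finite (verts G)" "Zt_exists G" "v \<in> verts G"
  shows "\<exists>u. v \<in> neighbors G u"
proof (rule ccontr)
  assume iso: "\<nexists>u. v \<in> neighbors G u"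
  obtain B x where "x \<in> B" and B: "\<And>x. x \<in> B \<Longrightarrow> zero_forcing_set G (B - {x})"
    using assms(1,2) by (auto simp: Zt_exists_def fault_tolerant_zfs_iff)
  then have in_diff: "v \<in> B - {x}" if "x \<in> B" for x
    using isolated_vertex_in_zero_forcing_set[of G "B - {x}" v] assms(3) iso that by blast
  then have "v \<in> B" using \<open>x \<in> B\<close> by blast
  then show False using in_diff by blast
qed

lemma neighbors_del_vert:
  "neighbors (pre_digraph.del_vert G v) b = (if b = v then {} else neighbors G b - {v})"
  by (auto simp: neighbors_def arcs_ends_conv pre_digraph.del_vert_simps)

lemma color_change_del_vert_simulate:
  assumes "(color_change (pre_digraph.del_vert G v))\<^sup>*\<^sup>* B X" "B \<subseteq> C" "v \<in> C"
  shows "\<exists>Y. (color_change G)\<^sup>*\<^sup>* C Y \<and> X \<subseteq> Y"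
  using assms
  by (intro color_change_rtranclp_simulate[OF assms(1)]) (auto simp: neighbors_del_vert)

lemma zero_forcing_set_del_vert_insert:
  assumes "zero_forcing_set (pre_digraph.del_vert G v) B"
    and "B \<subseteq> C" "v \<in> C" "C \<subseteq> verts G"
  shows "zero_forcing_set G C"
proof -
  obtain Y where Y: "(color_change G)\<^sup>*\<^sup>* C Y" "verts (pre_digraph.del_vert G v) \<subseteq> Y"
    using color_change_del_vert_simulate[of G v B "verts (pre_digraph.del_vert G v)" C] assms
    unfolding zero_forcing_set_def by blast
  then have "verts G \<subseteq> Y"
    using color_change_rtranclp_subset(1)[OF Y(1)] assms(3)
    by (auto simp: pre_digraph.del_vert_simps)
  then show ?thesis using zero_forcing_setI Y(1) assms(4) by blast
qed

text \<open>The process stays valid in \<open>G\<close> until the first force whose source is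
  adjacent to \<open>v\<close>; its target becomes \<open>w\<close>. The second alternative does not
  mention \<open>X\<close>, so later steps preserve it.\<close>

lemma color_change_del_vert_or_forced:
  assumes "(color_change (pre_digraph.del_vert G v))\<^sup>*\<^sup>* B X"
  shows "(color_change G)\<^sup>*\<^sup>* B X \<or>
    (\<exists>w\<in>verts G - {v}. \<exists>Y. (color_change G)\<^sup>*\<^sup>* (insert w B) Y \<and> v \<in> Y)"
  using assms
proof induction
  case base
  then show ?case by blast
next
  case (step X X')
  let ?H = "pre_digraph.del_vert G v"
  obtain b w where b: "b \<in> X" "neighbors ?H b - X = {w}" "X' = insert w X"
    using step.hyps(2) by (auto simp: color_change_def)
  then have nb: "neighbors ?H b = neighbors G b - {v}"
    by (auto simp: neighbors_del_vert split: if_splits)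
  have w: "w \<in> verts G - {v}" using b(2) nb by (auto simp: neighbors_def)
  from step.IH show ?case
  proof (elim disjE)
    assume BX: "(color_change G)\<^sup>*\<^sup>* B X"
    show ?case
    proof (cases "v \<in> neighbors G b")
      case False
      then have "color_change G X X'" using b nb by (auto simp: color_change_def)
      then show ?thesis using BX by (meson rtranclp.rtrancl_into_rtrancl)
    next
      case True
      \<comment> \<open>Adding \<open>w\<close> at the start cannot slow the process down, so
        \<open>b\<close> is blue in \<open>Y\<close>.\<close>
      obtain Y where Y: "(color_change G)\<^sup>*\<^sup>* (insert w B) Y" "X \<subseteq> Y"
        using color_change_rtranclp_simulate[OF BX, of "insert w B" G] by blast
      have "w \<in> Y" using color_change_rtranclp_subset(1)[OF Y(1)] by blast
      have "\<exists>Y. (color_change G)\<^sup>*\<^sup>* (insert w B) Y \<and> v \<in> Y"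
      proof (cases "v \<in> Y")
        case True
        then show ?thesis using Y by blast
      next
        case False
        \<comment> \<open>All neighbors of \<open>b\<close> other than \<open>v\<close> are now
          blue, so \<open>b\<close> can force \<open>v\<close>.\<close>
        have "neighbors G b - {v} \<subseteq> insert w X" using b(2) unfolding nb by blast
        then have "neighbors G b - Y = {v}"
          using True False \<open>w \<in> Y\<close> Y(2) by auto
        then have "color_change G Y (insert v Y)"
          using b(1) Y(2) by (auto simp: color_change_def)
        then show ?thesis using Y(1) by (meson insertI1 rtranclp.rtrancl_into_rtrancl)
      qed
      then show ?thesis using w by blast
    qed
  qed blast
qed

lemma zero_forcing_set_insert_of_del_vert:
  assumes B: "zero_forcing_set (pre_digraph.del_vert G v) B"
    and v: "v \<in> verts G" "u \<noteq> v" "u \<in> verts G" "v \<in> neighbors G u"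
  shows "\<exists>w\<in>verts G - {v}. zero_forcing_set G (insert w B)"
proof -
  let ?H = "pre_digraph.del_vert G v"
  have VH: "verts ?H = verts G - {v}" by (simp add: pre_digraph.del_vert_simps)
  have sub: "B \<subseteq> verts G - {v}" and reach: "(color_change ?H)\<^sup>*\<^sup>* B (verts G - {v})"
    using B by (auto simp: zero_forcing_set_def VH)
  from color_change_del_vert_or_forced[OF reach] show ?thesis
  proof (elim disjE bexE exE conjE)
    assume r: "(color_change G)\<^sup>*\<^sup>* B (verts G - {v})"
    have "neighbors G u - (verts G - {v}) = {v}"
      using v by (auto simp: neighbors_def)
    then have "color_change G (verts G - {v}) (insert v (verts G - {v}))"
      using v by (auto simp: color_change_def)
    then have "(color_change G)\<^sup>*\<^sup>* B (insert v (verts G - {v}))"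
      using r by (meson rtranclp.rtrancl_into_rtrancl)
    then have "zero_forcing_set G B" using sub by (auto intro: zero_forcing_setI)
    \<comment> \<open>Here \<open>B\<close> alone suffices, and \<open>u\<close> merely serves as
      some vertex other than \<open>v\<close>.\<close>
    then show ?thesis using zero_forcing_set_mono[of G B "insert u B"] sub v by blast
  next
    fix w Y
    assume w: "w \<in> verts G - {v}" and Y: "(color_change G)\<^sup>*\<^sup>* (insert w B) Y" "v \<in> Y"
    have "insert w B \<subseteq> Y" "Y \<subseteq> verts G"
      using color_change_rtranclp_subset[OF Y(1)] w sub by auto
    \<comment> \<open>Since \<open>Y\<close> contains \<open>B\<close> and \<open>v\<close>, the
      process of \<open>G - v\<close> can be rerun from \<open>Y\<close>.\<close>
    then have "zero_forcing_set G Y"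
      using zero_forcing_set_del_vert_insert[OF B, of Y] Y(2) by blast
    then have "(color_change G)\<^sup>*\<^sup>* (insert w B) (verts G)"
      using Y(1) by (auto simp: zero_forcing_set_def)
    then show ?thesis using w sub by (auto intro: zero_forcing_setI)
  qed
qed

theorem theorem4p7:
  fixes G :: "('a, 'b) pre_digraph" and v :: 'a
  assumes "graph G"
    and "Zt_exists G"
    and "v \<in> verts G"
    and "\<not> (\<exists>u. isolated_vertex (pre_digraph.del_vert G v) u)"
  shows "int (Zt G) - int (Zt (pre_digraph.del_vert G v)) \<le> 2"
proof -
  interpret graph G by fact
  let ?H = "pre_digraph.del_vert G v"
  have VH: "verts ?H = verts G - {v}" by (simp add: del_vert_simps)
  have "Zt_exists ?H" by (rule Zt_exists_del_vert) (use assms in auto)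
  then obtain B where B: "fault_tolerant_zfs ?H B" "card B = Zt ?H"
    by (rule Zt_attained)
  then have sub: "B \<subseteq> verts G - {v}" and "B \<noteq> {}"
    and ft: "\<And>x. x \<in> B \<Longrightarrow> zero_forcing_set ?H (B - {x})"
    using fault_tolerant_zfs_iff[of ?H B] VH by auto
  then have zB: "zero_forcing_set ?H B"
    using zero_forcing_set_mono[of ?H _ B] VH by blast
  obtain u where u: "v \<in> neighbors G u"
    using Zt_exists_imp_neighbor[OF finite_verts assms(2,3)] by blast
  then have "u \<noteq> v" "u \<in> verts G"
    using no_loops by (auto simp: neighbors_def arcs_ends_conv)
  then obtain w where w: "w \<in> verts G - {v}" "zero_forcing_set G (insert w B)"
    using zero_forcing_set_insert_of_del_vert[OF zB assms(3)] u by blast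
  let ?C = "insert v (insert w B)"
  have C: "?C \<subseteq> verts G" using sub w assms(3) by blast
  have "zero_forcing_set G (?C - {x})" if "x \<in> ?C" for x
  proof (cases "x = v")
    case True
    then have "?C - {x} = insert w B" using sub w(1) by blast
    then show ?thesis using w(2) by simp
  next
    case False
    \<comment> \<open>When \<open>x\<close> is \<open>w\<close> and \<open>w\<close> is not in
      \<open>B\<close>, nothing is lost from \<open>B\<close>, and \<open>zB\<close>
      applies.\<close>
    have "zero_forcing_set ?H (B - {x})" using ft zB by (cases "x \<in> B") auto
    then show ?thesis
      by (rule zero_forcing_set_del_vert_insert) (use False C in auto)
  qed
  then have "fault_tolerant_zfs G ?C" using C by (simp add: fault_tolerant_zfs_iff)
  then have "Zt G \<le> card ?C" by (rule Zt_le_card)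
  \<comment> \<open>Only an inequality, since \<open>w\<close> may already belong to
    \<open>B\<close>.\<close>
  also have "\<dots> \<le> card B + 2"
    using finite_subset[OF sub] by (simp add: card_insert_if)
  finally show ?thesis using B(2) by simp
qed

end
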